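(* Let $G$ be a symmetric-simplicial group, let $n\ge 0$, and let $\alpha(\cdot):\{0,1,\ldots,2^n-1\}\to J^{(n)}$ be a bijection (a total order on the set $J^{(n)}$ of symmetric multi-indices of dimension $\le n$) extending the inclusion partial order, i.e. such that $\alpha(k)\subseteq\alpha(l)$ implies $k\le l$ for all $k,l$. Write $U_k:=U_{\alpha(k)}$. Then there is an internal semidirect product (SDP) decomposition $$G_n = U_0 \rtimes U_1 \rtimes \cdots \rtimes U_{2^n-1}.$$
   Context: Let $\mathbf{Fin}$ be the category whose objects are the sets $[n]=\{0,1,\ldots,n\}$, $n\ge 0$, and whose morphisms are all maps between them. A symmetric-simplicial group is a functor $G:\mathbf{Fin}^{op}\to\mathbf{Groups}$; write $G_n=G([n])$ (not necessarily abelian, written additively). A map in $\mathbf{Fin}$ and the homomorphism it induces on $G$ are denoted by the same symbol; products of operators are composites of the induced homomorphisms acting on the left (i.e. composition in $\mathbf{Fin}^{op}$). Faces: $d_i:G_n\to G_{n-1}$ ($0\le i\le n$) is induced by the unique monotonic injection $[n-1]\to[n]$ whose image omits $i$. Quasi-degeneracies: for $1\le i\le n+1$, $u_i:G_n\to G_{n+1}$ is induced by the map $[n+1]\to[n]$ sending $k\mapsto 0$ if $k=0$ or $k=i$, $k\mapsto k$ if $1\le k\le i-1$, and $k\mapsto k-1$ if $k>i$. Moore chains: $M_n=M_n(G):=\{g\in G_n: d_i(g)=0\text{ for all } i\ne0\}$. Symmetric multi-indices: a symmetric multi-index $\alpha$ of length $k$ and dimension $\le n$ is a strictly increasing sequence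 $\alpha=\{i_1<\cdots<i_k\}$ with $1\le i_p\le n$ for all $p$; $|\alpha|:=k$, and the empty one $\varnothing$ is allowed. $J^{(n)}$ is the set of all of these; it has $2^n$ elements and is partially ordered by inclusion (as sets of indices). Put $u_\alpha:=u_{i_k}u_{i_{k-1}}\cdots u_{i_1}:G_{n-|\alpha|}\to G_n$ (with $u_\varnothing=\mathrm{id}$) and $U_\alpha:=u_\alpha(M_{n-|\alpha|})\subseteq G_n$; in particular $U_\varnothing=M_n$. Internal SDP: a group $G$ with subgroups $H_1,\ldots,H_r$ (in this order) is an internal $r$-semidirect product of the $H_i$, written $G=H_1\rtimes\cdots\rtimes H_r$, if (1) the set $H_1H_2\cdots H_i$ is a normal subgroup of $G$ for all $i$; and (2) every $g\in G$ can be factored uniquely as $g=h_1h_2\cdots h_r$ with $h_i\in H_i$ for all $i$. (Here this is applied with $r=2^n$ subgroups indexed from $0$ to $2^n-1$, in additive notation.) *)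

theory Defs
  imports "HOL-Algebra.Coset"
begin

text \<open>The category \<open>Fin\<close>: the object \<open>[n]\<close> is \<open>{..n}\<close>. Maps are taken to be extensional,
  so that the hom-sets contain each map exactly once.\<close>

definition fin_hom :: "nat \<Rightarrow> nat \<Rightarrow> (nat \<Rightarrow> nat) set" where
  "fin_hom m n = {..m} \<rightarrow>\<^sub>E {..n}"

text \<open>A functor from the opposite of \<open>Fin\<close> to groups: \<open>act m n f\<close> is the homomorphism from
  \<open>G n\<close> to \<open>G m\<close> induced by \<open>f \<in> fin_hom m n\<close>. The groups are not assumed abelian; they are
  written multiplicatively, as everywhere in HOL-Algebra.\<close>

locale symmetric_simplicial_group =
  fixes G :: "nat \<Rightarrow> ('a, 'b) monoid_scheme"
    and act :: "nat \<Rightarrow> nat \<Rightarrow> (nat \<Rightarrow> nat) \<Rightarrow> 'a \<Rightarrow> 'a"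
  assumes group_G: "group (G n)"
    and act_hom: "f \<in> fin_hom m n \<Longrightarrow> act m n f \<in> hom (G n) (G m)"
    and act_id: "x \<in> carrier (G n) \<Longrightarrow> act n n (\<lambda>k\<in>{..n}. k) x = x"
    and act_comp: "\<lbrakk>f \<in> fin_hom l m; g \<in> fin_hom m n; x \<in> carrier (G n)\<rbrakk>
      \<Longrightarrow> act l n (compose {..l} g f) x = act l m f (act m n g x)"

definition coface :: "nat \<Rightarrow> nat \<Rightarrow> nat \<Rightarrow> nat" where
  "coface n i = (\<lambda>k\<in>{..n - 1}. if k < i then k else k + 1)"

text \<open>\<open>face act n i\<close> is the face operator \<open>d\<^sub>i\<close> from \<open>G n\<close> to \<open>G (n - 1)\<close>; it is meaningful for
  \<open>n \<ge> 1\<close> and \<open>i \<le> n\<close> only.\<close>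

definition face :: "(nat \<Rightarrow> nat \<Rightarrow> (nat \<Rightarrow> nat) \<Rightarrow> 'a \<Rightarrow> 'a) \<Rightarrow> nat \<Rightarrow> nat \<Rightarrow> 'a \<Rightarrow> 'a" where
  "face act n i = act (n - 1) n (coface n i)"

definition quasi_codegen :: "nat \<Rightarrow> nat \<Rightarrow> nat \<Rightarrow> nat" where
  "quasi_codegen n i = (\<lambda>k\<in>{..n + 1}. if k = 0 \<or> k = i then 0 else if k < i then k else k - 1)"

text \<open>\<open>quasi_degen act n i\<close> is the quasi-degeneracy \<open>u\<^sub>i\<close> from \<open>G n\<close> to \<open>G (n + 1)\<close>, meaningful
  for \<open>1 \<le> i \<le> n + 1\<close>.\<close>

definition quasi_degen :: "(nat \<Rightarrow> nat \<Rightarrow> (nat \<Rightarrow> nat) \<Rightarrow> 'a \<Rightarrow> 'a) \<Rightarrow> nat \<Rightarrow> nat \<Rightarrow> 'a \<Rightarrow> 'a" where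
  "quasi_degen act n i = act (n + 1) n (quasi_codegen n i)"

text \<open>The range of \<open>i\<close> is empty for \<open>n = 0\<close> (there are no faces on \<open>G 0\<close>), so the Moore chains
  of dimension 0 are all of \<open>G 0\<close>.\<close>

definition moore_chains ::
  "(nat \<Rightarrow> ('a, 'b) monoid_scheme) \<Rightarrow> (nat \<Rightarrow> nat \<Rightarrow> (nat \<Rightarrow> nat) \<Rightarrow> 'a \<Rightarrow> 'a) \<Rightarrow> nat \<Rightarrow> 'a set" where
  "moore_chains G act n = {g \<in> carrier (G n). \<forall>i\<in>{1..n}. face act n i g = \<one>\<^bsub>G (n - 1)\<^esub>}"

text \<open>Symmetric multi-indices of dimension at most \<open>n\<close>, as strictly increasing lists; inclusion
  of multi-indices is inclusion of their sets of entries.\<close>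

definition sym_multi_indices :: "nat \<Rightarrow> nat list set" where
  "sym_multi_indices n = {\<alpha>. sorted_wrt (<) \<alpha> \<and> set \<alpha> \<subseteq> {1..n}}"

text \<open>\<open>multi_quasi_degen act m \<alpha>\<close> is \<open>u\<^sub>\<alpha>\<close> as a map from \<open>G m\<close> to \<open>G (m + length \<alpha>)\<close>. The smallest
  (first) index is applied first.\<close>

primrec multi_quasi_degen ::
  "(nat \<Rightarrow> nat \<Rightarrow> (nat \<Rightarrow> nat) \<Rightarrow> 'a \<Rightarrow> 'a) \<Rightarrow> nat \<Rightarrow> nat list \<Rightarrow> 'a \<Rightarrow> 'a" where
  "multi_quasi_degen act m [] x = x"
| "multi_quasi_degen act m (i # \<alpha>) x = multi_quasi_degen act (m + 1) \<alpha> (quasi_degen act m i x)"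

definition U_set ::
  "(nat \<Rightarrow> ('a, 'b) monoid_scheme) \<Rightarrow> (nat \<Rightarrow> nat \<Rightarrow> (nat \<Rightarrow> nat) \<Rightarrow> 'a \<Rightarrow> 'a)
    \<Rightarrow> nat \<Rightarrow> nat list \<Rightarrow> 'a set" where
  "U_set G act n \<alpha> =
    multi_quasi_degen act (n - length \<alpha>) \<alpha> ` moore_chains G act (n - length \<alpha>)"

text \<open>Internal semidirect product of the list \<open>Hs\<close> of subgroups, in this order. The case \<open>i = 0\<close>
  of the normality condition is the trivial subgroup, hence no extra requirement.\<close>

definition internal_sdp :: "('a, 'b) monoid_scheme \<Rightarrow> 'a set list \<Rightarrow> bool" where
  "internal_sdp G Hs \<longleftrightarrow>
    group G \<and>
    (\<forall>H\<in>set Hs. subgroup H G) \<and>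
    (\<forall>i\<le>length Hs. foldr (set_mult G) (take i Hs) {\<one>\<^bsub>G\<^esub>} \<lhd> G) \<and>
    (\<forall>g\<in>carrier G. \<exists>!hs. hs \<in> listset Hs \<and> g = foldr (mult G) hs \<one>\<^bsub>G\<^esub>)"

end

theory Submission
  imports Defs
begin

text \<open>For a set \<open>S\<close> of indices let \<open>\<epsilon>\<^sub>S\<close> be the endomorphism of \<open>G\<^sub>n\<close> induced by the map \<open>[n] \<rightarrow> [n]\<close>
  that collapses \<open>S\<close> to \<open>0\<close> and fixes everything else. Since \<open>0\<close> is fixed by all these maps, they
  multiply as \<open>\<epsilon>\<^sub>S \<epsilon>\<^sub>T = \<epsilon>\<^bsub>S \<union> T\<^esub>\<close> (\<open>collapsing_Un\<close>); so they are commuting idempotents, one for each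
  subset of \<open>{1..n}\<close>, and all of the theorem takes place inside the single group \<open>G\<^sub>n\<close>.

  The relations \<open>d\<^sub>i u\<^sub>i = id\<close> and \<open>u\<^sub>i d\<^sub>i = \<epsilon>\<^bsub>{i}\<^esub>\<close> show that \<open>d\<^sub>i\<close> and \<open>\<epsilon>\<^bsub>{i}\<^esub>\<close> have the same kernel, and
  they identify \<open>U\<^sub>\<alpha>\<close>, with \<open>A\<close> the set of entries of \<open>\<alpha>\<close>, as the simultaneous eigenspace of the
  elements that \<open>\<epsilon>\<^sub>A\<close> fixes and that \<open>\<epsilon>\<^bsub>{i}\<^esub>\<close> kills for every other \<open>i\<close> (\<open>U_set_eq_component\<close>).

  Let \<open>A\<^sub>0, A\<^sub>1, \<dots>\<close> be the subsets of \<open>{1..n}\<close> in the given order, and let \<open>N\<^sub>i\<close> be the intersection of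
  the kernels of \<open>\<epsilon>\<^bsub>A\<^sub>k\<^esub>\<close> over \<open>k \<ge> i\<close>. As an intersection of kernels it is normal; \<open>N\<^sub>0\<close> is trivial
  because \<open>\<epsilon>\<^bsub>{}\<^esub>\<close> is the identity, and the last \<open>N\<^sub>i\<close> is the whole group. The endomorphism
  \<open>\<epsilon>\<^bsub>A\<^sub>i\<^esub>\<close> restricts to a retraction of \<open>N\<^bsub>i+1\<^esub>\<close> onto \<open>U\<^sub>i\<close> with kernel \<open>N\<^sub>i\<close>: for \<open>g\<close> in \<open>N\<^bsub>i+1\<^esub>\<close>
  and \<open>j \<notin> A\<^sub>i\<close>, the larger set \<open>A\<^sub>i \<union> {j}\<close> comes later in the order, so \<open>\<epsilon>\<^bsub>{j}\<^esub>\<close> kills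
  \<open>\<epsilon>\<^bsub>A\<^sub>i\<^esub> g\<close>. Hence \<open>U\<^sub>i\<close> is a complement of \<open>N\<^sub>i\<close> in \<open>N\<^bsub>i+1\<^esub>\<close>, and a filtration by normal subgroups
  with chosen complements is an internal semidirect product (\<open>internal_sdp_of_filtration\<close>).\<close>

section \<open>Semidirect products from filtrations\<close>

lemma listset_snoc: "hs \<in> listset (Hs @ [H]) \<longleftrightarrow> (\<exists>ks h. hs = ks @ [h] \<and> ks \<in> listset Hs \<and> h \<in> H)"
proof (induction Hs arbitrary: hs)
  case Nil
  then show ?case by (auto simp: set_Cons_def)
next
  case (Cons K Hs)
  show ?case
    by (cases hs) (auto simp: set_Cons_def Cons.IH Cons_eq_append_conv)
qed

context group
begin

lemma listset_subset_carrier: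
  "\<forall>H\<in>set Hs. H \<subseteq> carrier G \<Longrightarrow> hs \<in> listset Hs \<Longrightarrow> set hs \<subseteq> carrier G"
proof (induction Hs arbitrary: hs)
  case (Cons K Hs)
  then obtain k ks where "hs = k # ks" "k \<in> K" "ks \<in> listset Hs"
    by (auto simp: set_Cons_def)
  then show ?case using Cons.IH[of ks] Cons.prems(1) by auto
qed simp

lemma foldr_mult_closed: "set hs \<subseteq> carrier G \<Longrightarrow> foldr (\<otimes>) hs \<one> \<in> carrier G"
  by (induction hs) auto

lemma foldr_mult_snoc:
  "set hs \<subseteq> carrier G \<Longrightarrow> h \<in> carrier G \<Longrightarrow> foldr (\<otimes>) (hs @ [h]) \<one> = foldr (\<otimes>) hs \<one> \<otimes> h"
  by (induction hs) (auto simp: m_assoc foldr_mult_closed simp del: foldr_append)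

lemma foldr_set_mult_closed:
  "\<forall>H\<in>set Hs. H \<subseteq> carrier G \<Longrightarrow> foldr (<#>) Hs {\<one>} \<subseteq> carrier G"
  by (induction Hs) (simp_all add: set_mult_closed)

lemma foldr_set_mult_snoc:
  assumes "\<forall>K\<in>set Hs. K \<subseteq> carrier G" "H \<subseteq> carrier G"
  shows "foldr (<#>) (Hs @ [H]) {\<one>} = foldr (<#>) Hs {\<one>} <#> H"
  using assms
proof (induction Hs)
  case Nil
  have "H <#> {\<one>} = H" "{\<one>} <#> H = H"
    using Nil by (force simp: set_mult_def)+
  then show ?case by simp
next
  case (Cons K Hs)
  then have "K <#> foldr (<#>) (Hs @ [H]) {\<one>} = K <#> (foldr (<#>) Hs {\<one>} <#> H)"
    by (simp del: foldr_append)
  also have "\<dots> = K <#> foldr (<#>) Hs {\<one>} <#> H"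
    using Cons.prems foldr_set_mult_closed[of Hs] by (intro set_mult_assoc[symmetric]) auto
  finally show ?case by simp
qed

text \<open>The subgroup \<open>N i\<close> turns out to be the product of the first \<open>i\<close> factors. The last factor of an
  element of \<open>N (Suc i)\<close> is determined because \<open>H i\<close> meets \<open>N i\<close> trivially; cancelling it leaves an
  element of \<open>N i\<close>, so factorizations are unique by induction.\<close>

lemma internal_sdp_of_filtration:
  assumes N0: "N 0 = {\<one>}" and Nr: "N r = carrier G"
    and normal: "\<And>i. i \<le> r \<Longrightarrow> N i \<lhd> G"
    and sub: "\<And>i. i < r \<Longrightarrow> subgroup (H i) G"
    and mult: "\<And>i. i < r \<Longrightarrow> N i <#> H i = N (Suc i)"
    and inter: "\<And>i. i < r \<Longrightarrow> N i \<inter> H i = {\<one>}"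
  shows "internal_sdp G (map H [0..<r])"
proof -
  have H_carrier: "\<forall>K\<in>set (map H [0..<i]). K \<subseteq> carrier G" if "i \<le> r" for i
    using that by (auto dest!: subgroup.mem_carrier[OF sub, rotated])
  have product: "foldr (<#>) (map H [0..<i]) {\<one>} = N i" if "i \<le> r" for i
    using that
  proof (induction i)
    case 0
    show ?case by (simp add: N0)
  next
    case (Suc i)
    have "foldr (<#>) (map H [0..<i] @ [H i]) {\<one>} = foldr (<#>) (map H [0..<i]) {\<one>} <#> H i"
      using Suc.prems by (intro foldr_set_mult_snoc H_carrier subgroup.subset sub) auto
    then show ?case using Suc mult by simp
  qed
  have factor_mem: "foldr (\<otimes>) hs \<one> \<in> N i" if "i \<le> r" "hs \<in> listset (map H [0..<i])" for i hs
  proof -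
    have "foldr (\<otimes>) hs \<one> \<in> foldr (<#>) Hs {\<one>}" if "hs \<in> listset Hs" for Hs
      using that by (induction Hs arbitrary: hs) (force simp: set_Cons_def set_mult_def)+
    then show ?thesis using that product by blast
  qed
  have unique: "\<exists>!hs. hs \<in> listset (map H [0..<i]) \<and> g = foldr (\<otimes>) hs \<one>"
    if "i \<le> r" "g \<in> N i" for i g
    using that
  proof (induction i arbitrary: g)
    case 0
    then show ?case using N0 by auto
  next
    case (Suc i)
    then have i: "i < r" "i \<le> r" by auto
    interpret Ni: normal "N i" G by (rule normal[OF i(2)])
    interpret Hi: subgroup "H i" G by (rule sub[OF i(1)])
    have snoc: "foldr (\<otimes>) (hs @ [h]) \<one> = foldr (\<otimes>) hs \<one> \<otimes> h"
      if "hs \<in> listset (map H [0..<i])" "h \<in> H i" for hs h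
      using that listset_subset_carrier[OF H_carrier[OF i(2)]] by (intro foldr_mult_snoc) auto
    obtain x h where xh: "x \<in> N i" "h \<in> H i" "g = x \<otimes> h"
      using Suc.prems(2) unfolding mult[OF i(1), symmetric] by (auto simp: set_mult_def)
    obtain hs where hs: "hs \<in> listset (map H [0..<i])" "x = foldr (\<otimes>) hs \<one>"
      and hs_unique: "\<forall>ks. ks \<in> listset (map H [0..<i]) \<and> x = foldr (\<otimes>) ks \<one> \<longrightarrow> ks = hs"
      using Suc.IH[OF i(2) xh(1)] unfolding Ex1_def by (elim exE conjE) (rule that)
    show ?case
    proof (rule ex1I[of _ "hs @ [h]"])
      show "hs @ [h] \<in> listset (map H [0..<Suc i]) \<and> g = foldr (\<otimes>) (hs @ [h]) \<one>"
        using hs xh snoc[OF hs(1) xh(2)] by (simp add: listset_snoc del: foldr_append)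
    next
      fix ks assume ks: "ks \<in> listset (map H [0..<Suc i]) \<and> g = foldr (\<otimes>) ks \<one>"
      then obtain hs' h' where ks_eq: "ks = hs' @ [h']" and hs': "hs' \<in> listset (map H [0..<i])"
        and h': "h' \<in> H i"
        by (auto simp: listset_snoc)
      define x' where "x' = foldr (\<otimes>) hs' \<one>"
      have x': "x' \<in> N i" using factor_mem[OF i(2) hs'] by (simp add: x'_def)
      have eq: "x \<otimes> h = x' \<otimes> h'"
        using ks ks_eq snoc[OF hs' h'] xh(3) by (simp add: x'_def)
      have c: "x \<in> carrier G" "x' \<in> carrier G" "h \<in> carrier G" "h' \<in> carrier G"
        using xh x' h' by auto
      have "inv x' \<otimes> x = h' \<otimes> inv h"
      proof -
        have "x = x' \<otimes> h' \<otimes> inv h" using c by (subst inv_solve_right) (simp_all add: eq)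
        then show ?thesis using c by (simp add: m_assoc inv_solve_left')
      qed
      moreover have "inv x' \<otimes> x \<in> N i" "h' \<otimes> inv h \<in> H i"
        using xh x' h' by auto
      ultimately have "h' \<otimes> inv h = \<one>"
        using inter[OF i(1)] by auto
      then have "h' = h" using c inv_equality[of h' "inv h"] by simp
      moreover from this have "x' = x" using eq c by simp
      then have "hs' = hs"
        using hs_unique hs' by (simp add: x'_def)
      ultimately show "ks = hs @ [h]" by (simp add: ks_eq)
    qed
  qed
  show ?thesis
    unfolding internal_sdp_def
  proof (intro conjI ballI allI impI)
    show "group G" by (rule is_group)
    show "subgroup K G" if "K \<in> set (map H [0..<r])" for K
      using that sub by auto
    show "foldr (<#>) (take i (map H [0..<r])) {\<one>} \<lhd> G" if "i \<le> length (map H [0..<r])" for i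
      using that product[of i] normal[of i] by (simp add: take_map)
    show "\<exists>!hs. hs \<in> listset (map H [0..<r]) \<and> g = foldr (\<otimes>) hs \<one>" if "g \<in> carrier G" for g
      using that unique[of r g] Nr by simp
  qed
qed

end

section \<open>Collapsing endomorphisms and their components\<close>

definition collapse :: "nat \<Rightarrow> nat set \<Rightarrow> nat \<Rightarrow> nat" where
  "collapse n S = (\<lambda>k\<in>{..n}. if k \<in> S then 0 else k)"

lemma collapse_fin_hom: "collapse n S \<in> fin_hom n n"
  by (auto simp: collapse_def fin_hom_def)

lemma coface_fin_hom: "coface (Suc n) i \<in> fin_hom n (Suc n)"
  by (auto simp: coface_def fin_hom_def)

lemma quasi_codegen_fin_hom: "i \<le> n + 1 \<Longrightarrow> quasi_codegen n i \<in> fin_hom (Suc n) n"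
  by (auto simp: quasi_codegen_def fin_hom_def)

text \<open>The quasi-codegeneracy is injective outside the preimage of \<open>0\<close>, which is why collapsing
  before it agrees with collapsing the image after it.\<close>

lemma quasi_codegen_collapse:
  assumes "1 \<le> j" "j \<le> n + 1" "S \<subseteq> {..n + 1}"
  shows "compose {..Suc n} (quasi_codegen n j) (collapse (Suc n) S) =
    compose {..Suc n} (collapse n (quasi_codegen n j ` S)) (quasi_codegen n j)"
proof
  fix k
  have inj: "l = k" if "quasi_codegen n j k = quasi_codegen n j l" "quasi_codegen n j k \<noteq> 0"
    "k \<le> Suc n" "l \<le> Suc n" for l
    using that assms by (auto simp: quasi_codegen_def split: if_splits)
  have le: "quasi_codegen n j k \<le> n" if "k \<le> Suc n"
    using that assms by (auto simp: quasi_codegen_def)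
  have zero: "quasi_codegen n j 0 = 0" by (simp add: quasi_codegen_def)
  show "compose {..Suc n} (quasi_codegen n j) (collapse (Suc n) S) k =
    compose {..Suc n} (collapse n (quasi_codegen n j ` S)) (quasi_codegen n j) k"
  proof (cases "k \<le> Suc n")
    case True
    have "quasi_codegen n j k = 0" if "k \<notin> S" "quasi_codegen n j k \<in> quasi_codegen n j ` S"
      using that inj[OF _ _ True] assms(3) by fastforce
    then show ?thesis
      using True le zero by (auto simp: compose_def collapse_def)
  qed (simp add: compose_def)
qed

context symmetric_simplicial_group
begin

definition collapsing :: "nat \<Rightarrow> nat set \<Rightarrow> 'a \<Rightarrow> 'a" where
  "collapsing n S = act n n (collapse n S)"

lemma collapsing_hom: "collapsing n S \<in> hom (G n) (G n)"
  unfolding collapsing_def by (intro act_hom collapse_fin_hom)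

lemma face_hom: "face act (Suc n) i \<in> hom (G (Suc n)) (G n)"
  unfolding face_def by (simp add: act_hom coface_fin_hom)

lemma quasi_degen_hom: "i \<le> n + 1 \<Longrightarrow> quasi_degen act n i \<in> hom (G n) (G (Suc n))"
  unfolding quasi_degen_def by (simp add: act_hom quasi_codegen_fin_hom)

lemma collapsing_group_hom: "group_hom (G n) (G n) (collapsing n S)"
  by (simp add: group_hom_def group_hom_axioms_def group_G collapsing_hom)

lemma quasi_degen_group_hom: "i \<le> n + 1 \<Longrightarrow> group_hom (G n) (G (Suc n)) (quasi_degen act n i)"
  by (simp add: group_hom_def group_hom_axioms_def group_G quasi_degen_hom)

lemma collapsing_closed [simp]: "g \<in> carrier (G n) \<Longrightarrow> collapsing n S g \<in> carrier (G n)"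
  using collapsing_hom by (rule hom_in_carrier)

lemma collapsing_one [simp]: "collapsing n S \<one>\<^bsub>G n\<^esub> = \<one>\<^bsub>G n\<^esub>"
  using collapsing_group_hom by (rule group_hom.hom_one)

lemma collapsing_empty [simp]: "g \<in> carrier (G n) \<Longrightarrow> collapsing n {} g = g"
  using act_id[of g n] by (simp add: collapsing_def collapse_def)

lemma collapsing_insert_0: "collapsing n (insert 0 S) = collapsing n S"
proof -
  have "collapse n (insert 0 S) = collapse n S"
    by (auto simp: collapse_def fun_eq_iff)
  then show ?thesis by (simp add: collapsing_def)
qed

lemma collapsing_Un:
  assumes "g \<in> carrier (G n)"
  shows "collapsing n S (collapsing n T g) = collapsing n (S \<union> T) g"
proof -
  have "compose {..n} (collapse n T) (collapse n S) = collapse n (S \<union> T)"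
    by (auto simp: collapse_def compose_def fun_eq_iff)
  then show ?thesis
    using act_comp[OF collapse_fin_hom collapse_fin_hom assms, of T S] by (simp add: collapsing_def)
qed

lemma face_quasi_degen:
  assumes "1 \<le> i" "i \<le> n + 1" "x \<in> carrier (G n)"
  shows "face act (Suc n) i (quasi_degen act n i x) = x"
proof -
  have "compose {..n} (quasi_codegen n i) (coface (Suc n) i) = (\<lambda>k\<in>{..n}. k)"
    using assms by (auto simp: compose_def quasi_codegen_def coface_def fun_eq_iff)
  then show ?thesis
    using act_comp[OF coface_fin_hom quasi_codegen_fin_hom[OF assms(2)] assms(3), of i] act_id assms
    by (simp add: face_def quasi_degen_def)
qed

lemma quasi_degen_face:
  assumes "1 \<le> i" "i \<le> n + 1" "g \<in> carrier (G (Suc n))"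
  shows "quasi_degen act n i (face act (Suc n) i g) = collapsing (Suc n) {i} g"
proof -
  have "compose {..Suc n} (coface (Suc n) i) (quasi_codegen n i) = collapse (Suc n) {i}"
    using assms by (auto simp: compose_def quasi_codegen_def coface_def collapse_def fun_eq_iff)
  then show ?thesis
    using act_comp[OF quasi_codegen_fin_hom[OF assms(2)] coface_fin_hom assms(3), of i]
    by (simp add: face_def quasi_degen_def collapsing_def)
qed

lemma quasi_degen_inj_on: "1 \<le> i \<Longrightarrow> i \<le> n + 1 \<Longrightarrow> inj_on (quasi_degen act n i) (carrier (G n))"
  by (rule inj_on_inverseI[where g = "face act (Suc n) i"]) (rule face_quasi_degen)

lemma collapsing_quasi_degen:
  assumes "1 \<le> j" "j \<le> n + 1" "S \<subseteq> {..n + 1}" "x \<in> carrier (G n)"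
  shows "collapsing (Suc n) S (quasi_degen act n j x) =
    quasi_degen act n j (collapsing n (quasi_codegen n j ` S) x)"
  using act_comp[OF collapse_fin_hom quasi_codegen_fin_hom[OF assms(2)] assms(4), of S]
    act_comp[OF quasi_codegen_fin_hom[OF assms(2)] collapse_fin_hom assms(4),
      of "quasi_codegen n j ` S"]
    quasi_codegen_collapse[OF assms(1-3)]
  by (simp add: collapsing_def quasi_degen_def)

definition component :: "nat \<Rightarrow> nat set \<Rightarrow> 'a set" where
  "component n A = {g \<in> carrier (G n). collapsing n A g = g \<and>
    (\<forall>i\<in>{1..n} - A. collapsing n {i} g = \<one>\<^bsub>G n\<^esub>)}"

lemma component_subgroup: "subgroup (component n A) (G n)"
proof -
  interpret group "G n" by (rule group_G)
  note h = group_hom.hom_mult[OF collapsing_group_hom] group_hom.hom_inv[OF collapsing_group_hom]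
  show ?thesis
    by (rule subgroupI) (auto simp: component_def h intro!: exI[of _ "\<one>\<^bsub>G n\<^esub>"])
qed

lemma collapsing_component_eq_one:
  assumes "g \<in> component n A" "B \<subseteq> {1..n}" "\<not> B \<subseteq> A"
  shows "collapsing n B g = \<one>\<^bsub>G n\<^esub>"
proof -
  obtain j where j: "j \<in> B" "j \<notin> A" using assms by auto
  then have "collapsing n B g = collapsing n B (collapsing n {j} g)"
    using assms by (subst collapsing_Un) (auto simp: component_def insert_absorb)
  then show ?thesis using assms j by (auto simp: component_def)
qed

lemma moore_chains_eq_component: "moore_chains G act n = component n {}"
proof -
  have "face act n i g = \<one>\<^bsub>G (n - 1)\<^esub> \<longleftrightarrow> collapsing n {i} g = \<one>\<^bsub>G n\<^esub>"
    if i: "i \<in> {1..n}" and g: "g \<in> carrier (G n)" for i g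
  proof -
    obtain m where m: "n = Suc m" using i by (cases n) auto
    have i': "1 \<le> i" "i \<le> m + 1" using i m by auto
    have one: "quasi_degen act m i \<one>\<^bsub>G m\<^esub> = \<one>\<^bsub>G n\<^esub>"
      unfolding m using group_hom.hom_one[OF quasi_degen_group_hom[OF i'(2)]] .
    have "\<one>\<^bsub>G m\<^esub> \<in> carrier (G m)"
      using group_G by (simp add: group.is_monoid monoid.one_closed)
    moreover have "face act n i g \<in> carrier (G m)"
      using hom_in_carrier[OF face_hom] g m by simp
    ultimately have "face act n i g = \<one>\<^bsub>G m\<^esub> \<longleftrightarrow>
        quasi_degen act m i (face act n i g) = quasi_degen act m i \<one>\<^bsub>G m\<^esub>"
      using quasi_degen_inj_on[OF i'] by (simp add: inj_on_eq_iff)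
    then show ?thesis using quasi_degen_face[OF i'] g one m by simp
  qed
  then show ?thesis by (auto simp: moore_chains_def component_def)
qed

text \<open>The restriction to \<open>A \<subseteq> {1..<j}\<close> is what makes \<open>u\<^sub>j\<close> leave the indices in \<open>A\<close> unshifted; it holds
  along a multi-index because its largest entry is applied last.\<close>

lemma quasi_degen_component:
  assumes j: "1 \<le> j" "j \<le> n + 1" and A: "A \<subseteq> {1..<j}"
  shows "quasi_degen act n j ` component n A = component (Suc n) (insert j A)"
proof -
  let ?u = "quasi_degen act n j" and ?p = "quasi_codegen n j"
  have one: "?u \<one>\<^bsub>G n\<^esub> = \<one>\<^bsub>G (Suc n)\<^esub>"
    using group_hom.hom_one[OF quasi_degen_group_hom[OF j(2)]] .
  have "?p a = a" if "a \<in> A" for a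
  proof -
    have "a < j" "a \<noteq> 0" "a \<le> n" using that A j by auto
    then show ?thesis by (simp add: quasi_codegen_def)
  qed
  moreover have "?p j = 0" using j by (simp add: quasi_codegen_def)
  ultimately have "?p ` insert j A = insert 0 A" by (auto simp: image_iff)
  then have comm_A: "collapsing (Suc n) (insert j A) (?u x) = ?u (collapsing n A x)"
    if "x \<in> carrier (G n)" for x
    using collapsing_quasi_degen[OF j, of "insert j A" x] that A j
    by (force simp: collapsing_insert_0)
  have comm_i: "collapsing (Suc n) {i} (?u x) = ?u (collapsing n {?p i} x)"
    if "x \<in> carrier (G n)" "i \<le> Suc n" for x i
    using collapsing_quasi_degen[OF j, of "{i}" x] that by simp
  show ?thesis
  proof (intro equalityI subsetI)
    fix g assume "g \<in> ?u ` component n A"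
    then obtain x where x: "x \<in> component n A" "g = ?u x" by auto
    have xc: "x \<in> carrier (G n)" using x by (simp add: component_def)
    have "collapsing (Suc n) {i} g = \<one>\<^bsub>G (Suc n)\<^esub>" if i: "i \<in> {1..Suc n} - insert j A" for i
    proof -
      have "?p i \<in> {1..n} - A"
        using i j A by (auto simp: quasi_codegen_def subset_eq)
      then have "collapsing n {?p i} x = \<one>\<^bsub>G n\<^esub>" using x(1) by (simp add: component_def)
      then show ?thesis using comm_i[OF xc, of i] i x(2) one by simp
    qed
    moreover have "collapsing (Suc n) (insert j A) g = g"
      using comm_A[OF xc] x by (simp add: component_def)
    moreover have "g \<in> carrier (G (Suc n))"
      using x(2) hom_in_carrier[OF quasi_degen_hom[OF j(2)] xc] by simp
    ultimately show "g \<in> component (Suc n) (insert j A)" by (simp add: component_def)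
  next
    fix g assume g: "g \<in> component (Suc n) (insert j A)"
    then have gc: "g \<in> carrier (G (Suc n))" by (simp add: component_def)
    define x where "x = face act (Suc n) j g"
    have xc: "x \<in> carrier (G n)" unfolding x_def using face_hom gc by (rule hom_in_carrier)
    have oc: "\<one>\<^bsub>G n\<^esub> \<in> carrier (G n)"
      using group_G by (simp add: group.is_monoid monoid.one_closed)
    note inj = inj_onD[OF quasi_degen_inj_on[OF j]]
    have "collapsing (Suc n) {j} g = collapsing (Suc n) {j} (collapsing (Suc n) (insert j A) g)"
      using g by (simp add: component_def)
    also have "\<dots> = collapsing (Suc n) (insert j A) g" using gc by (simp add: collapsing_Un)
    also have "\<dots> = g" using g by (simp add: component_def)
    finally have ux: "?u x = g" using quasi_degen_face[OF j gc] by (simp add: x_def)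
    have "collapsing n A x = x"
    proof (rule inj)
      show "?u (collapsing n A x) = ?u x"
        using comm_A[OF xc] ux g by (simp add: component_def)
    qed (simp_all add: xc)
    moreover have "collapsing n {i} x = \<one>\<^bsub>G n\<^esub>" if i: "i \<in> {1..n} - A" for i
    proof -
      define i' where "i' = (if i < j then i else i + 1)"
      have i': "?p i' = i" "i' \<in> {1..Suc n} - insert j A"
        using i j A by (auto simp: quasi_codegen_def i'_def subset_eq)
      then have "?u (collapsing n {i} x) = collapsing (Suc n) {i'} g"
        using comm_i[OF xc, of i'] ux by simp
      also have "\<dots> = ?u \<one>\<^bsub>G n\<^esub>" using g i'(2) one by (simp add: component_def)
      finally show ?thesis by (rule inj) (simp_all add: xc oc)
    qed
    ultimately have "x \<in> component n A" using xc by (simp add: component_def)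
    then show "g \<in> ?u ` component n A" using ux by blast
  qed
qed

lemma multi_quasi_degen_snoc:
  "multi_quasi_degen act m (\<alpha> @ [j]) x =
    quasi_degen act (m + length \<alpha>) j (multi_quasi_degen act m \<alpha> x)"
  by (induction \<alpha> arbitrary: m x) auto

lemma multi_quasi_degen_moore_chains:
  assumes "sorted_wrt (<) \<alpha>" "set \<alpha> \<subseteq> {1..m + length \<alpha>}"
  shows "multi_quasi_degen act m \<alpha> ` moore_chains G act m = component (m + length \<alpha>) (set \<alpha>)"
  using assms
proof (induction \<alpha> rule: rev_induct)
  case Nil
  then show ?case by (simp add: moore_chains_eq_component)
next
  case (snoc j \<alpha>)
  have lt: "set \<alpha> \<subseteq> {1..<j}" using snoc.prems by (auto simp: sorted_wrt_append)
  have "multi_quasi_degen act m (\<alpha> @ [j]) ` moore_chains G act m =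
      quasi_degen act (m + length \<alpha>) j ` (multi_quasi_degen act m \<alpha> ` moore_chains G act m)"
    by (simp add: image_image multi_quasi_degen_snoc)
  also have "multi_quasi_degen act m \<alpha> ` moore_chains G act m
      = component (m + length \<alpha>) (set \<alpha>)"
    using snoc.prems lt by (intro snoc.IH) (fastforce simp: sorted_wrt_append)+
  also have "quasi_degen act (m + length \<alpha>) j ` \<dots>
      = component (Suc (m + length \<alpha>)) (insert j (set \<alpha>))"
    using snoc.prems lt by (intro quasi_degen_component) auto
  finally show ?case by simp
qed

lemma U_set_eq_component:
  assumes "\<alpha> \<in> sym_multi_indices n"
  shows "U_set G act n \<alpha> = component n (set \<alpha>)"
proof -
  have \<alpha>: "sorted_wrt (<) \<alpha>" "set \<alpha> \<subseteq> {1..n}" using assms by (auto simp: sym_multi_indices_def)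
  have "length \<alpha> = card (set \<alpha>)"
    using \<alpha>(1) by (simp add: strict_sorted_iff distinct_card)
  also have "\<dots> \<le> n" using card_mono[OF _ \<alpha>(2)] by simp
  finally show ?thesis
    using multi_quasi_degen_moore_chains[of \<alpha> "n - length \<alpha>"] \<alpha> by (simp add: U_set_def)
qed

section \<open>The filtration by kernels\<close>

text \<open>In the application \<open>\<B>\<close> runs through the final segments of the given total order on subsets of
  \<open>{1..n}\<close>; letting \<open>\<B>\<close> shrink gives the filtration.\<close>

definition common_kernel :: "nat \<Rightarrow> nat set set \<Rightarrow> 'a set" where
  "common_kernel n \<B> = {g \<in> carrier (G n). \<forall>B\<in>\<B>. collapsing n B g = \<one>\<^bsub>G n\<^esub>}"

lemma common_kernel_normal: "common_kernel n \<B> \<lhd> G n"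
proof -
  interpret group "G n" by (rule group_G)
  note h = group_hom.hom_mult[OF collapsing_group_hom] group_hom.hom_inv[OF collapsing_group_hom]
  have "subgroup (common_kernel n \<B>) (G n)"
    by (rule subgroupI) (auto simp: common_kernel_def h intro!: exI[of _ "\<one>\<^bsub>G n\<^esub>"])
  then show ?thesis
    by (auto simp: normal_inv_iff common_kernel_def h)
qed

text \<open>On \<open>common_kernel n \<B>\<close> the endomorphism \<open>\<epsilon>\<^sub>A\<close> is a retraction onto \<open>component n A\<close>: its values are
  killed by \<open>\<epsilon>\<^bsub>{i}\<^esub>\<close> for \<open>i \<notin> A\<close> because \<open>A \<union> {i}\<close> belongs to \<open>\<B>\<close>. Hence \<open>g\<close> factors as
  \<open>(g (\<epsilon>\<^sub>A g)\<^sup>-\<^sup>1) (\<epsilon>\<^sub>A g)\<close>.\<close>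

lemma common_kernel_mult_component:
  assumes A: "A \<subseteq> {1..n}" and \<B>: "\<B> \<subseteq> Pow {1..n}"
    and up: "\<And>i. i \<in> {1..n} - A \<Longrightarrow> insert i A \<in> \<B>"
    and not_below: "\<And>B. B \<in> \<B> \<Longrightarrow> \<not> B \<subseteq> A"
  shows "common_kernel n (insert A \<B>) <#>\<^bsub>G n\<^esub> component n A = common_kernel n \<B>"
proof -
  interpret group "G n" by (rule group_G)
  note h = group_hom.hom_mult[OF collapsing_group_hom] group_hom.hom_inv[OF collapsing_group_hom]
  have le: "component n A \<subseteq> common_kernel n \<B>"
  proof
    fix g assume g: "g \<in> component n A"
    have "collapsing n B g = \<one>\<^bsub>G n\<^esub>" if "B \<in> \<B>" for B
      using g that \<B> not_below by (intro collapsing_component_eq_one) auto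
    then show "g \<in> common_kernel n \<B>" using g by (simp add: common_kernel_def component_def)
  qed
  show ?thesis
  proof (intro equalityI subsetI)
    fix g assume "g \<in> common_kernel n (insert A \<B>) <#>\<^bsub>G n\<^esub> component n A"
    then show "g \<in> common_kernel n \<B>"
      using le by (auto simp: set_mult_def common_kernel_def h subset_eq)
  next
    fix g assume g: "g \<in> common_kernel n \<B>"
    then have gc: "g \<in> carrier (G n)" by (simp add: common_kernel_def)
    let ?h = "collapsing n A g"
    have "collapsing n {i} ?h = \<one>\<^bsub>G n\<^esub>" if "i \<in> {1..n} - A" for i
      using up[OF that] g gc by (simp add: collapsing_Un common_kernel_def)
    then have h_mem: "?h \<in> component n A"
      using gc by (simp add: component_def collapsing_Un)
    have "collapsing n B ?h = \<one>\<^bsub>G n\<^esub>" if "B \<in> \<B>" for B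
      using h_mem that le by (auto simp: common_kernel_def)
    then have "g \<otimes>\<^bsub>G n\<^esub> inv\<^bsub>G n\<^esub> ?h \<in> common_kernel n (insert A \<B>)"
      using g gc by (auto simp: common_kernel_def h collapsing_Un)
    moreover have "g = (g \<otimes>\<^bsub>G n\<^esub> inv\<^bsub>G n\<^esub> ?h) \<otimes>\<^bsub>G n\<^esub> ?h"
      using gc by (simp add: m_assoc)
    ultimately show "g \<in> common_kernel n (insert A \<B>) <#>\<^bsub>G n\<^esub> component n A"
      using h_mem unfolding set_mult_def by blast
  qed
qed

lemma common_kernel_inter_component:
  "A \<in> \<B> \<Longrightarrow> common_kernel n \<B> \<inter> component n A = {\<one>\<^bsub>G n\<^esub>}"
  using group_G[of n]
  by (auto simp: common_kernel_def component_def group.is_monoid)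

lemma internal_sdp_components:
  assumes bij: "bij_betw A {0..<r} (Pow {1..n})"
    and ext: "\<And>k l. \<lbrakk>k < r; l < r; A k \<subseteq> A l\<rbrakk> \<Longrightarrow> k \<le> l"
  shows "internal_sdp (G n) (map (\<lambda>k. component n (A k)) [0..<r])"
proof -
  interpret group "G n" by (rule group_G)
  define N where "N i = common_kernel n (A ` {i..<r})" for i
  have surj: "\<exists>k<r. A k = B" if "B \<subseteq> {1..n}" for B
  proof -
    have "B \<in> A ` {0..<r}" using that bij_betw_imp_surj_on[OF bij] by blast
    then show ?thesis by auto
  qed
  have A_sub: "A k \<subseteq> {1..n}" if "k < r" for k
    using that bij_betwE[OF bij] by (auto simp del: atLeastAtMost_iff)
  show ?thesis
  proof (rule internal_sdp_of_filtration[where N = N])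
    have empty: "{} \<in> A ` {0..<r}" using surj[of "{}"] by force
    have "g = \<one>\<^bsub>G n\<^esub>" if "g \<in> N 0" for g
    proof -
      have "collapsing n {} g = \<one>\<^bsub>G n\<^esub>" "g \<in> carrier (G n)"
        using that empty unfolding N_def common_kernel_def by blast+
      then show ?thesis by simp
    qed
    moreover have "\<one>\<^bsub>G n\<^esub> \<in> N 0" by (simp add: N_def common_kernel_def)
    ultimately show "N 0 = {\<one>\<^bsub>G n\<^esub>}" by blast
    show "N r = carrier (G n)" by (simp add: N_def common_kernel_def)
    show "N i \<lhd> G n" for i by (simp add: N_def common_kernel_normal)
    show "subgroup (component n (A i)) (G n)" for i by (rule component_subgroup)
  next
    fix i assume i: "i < r"
    have interval: "{i..<r} = insert i {Suc i..<r}" using i by auto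
    show "N i <#>\<^bsub>G n\<^esub> component n (A i) = N (Suc i)"
      unfolding N_def interval image_insert
    proof (rule common_kernel_mult_component)
      fix j assume j: "j \<in> {1..n} - A i"
      then have "insert j (A i) \<subseteq> {1..n}" using A_sub[OF i] by blast
      then obtain k where k: "k < r" "A k = insert j (A i)" using surj by blast
      then have "i \<le> k" "i \<noteq> k" using ext[of i k] i j by auto
      then show "insert j (A i) \<in> A ` {Suc i..<r}" using k by (intro image_eqI[of _ _ k]) auto
    next
      fix B assume "B \<in> A ` {Suc i..<r}"
      then obtain k where "B = A k" "Suc i \<le> k" "k < r" by auto
      then show "\<not> B \<subseteq> A i" using ext[of k i] i by auto
    next
      show "A i \<subseteq> {1..n}" using A_sub[OF i] .
      have "A k \<in> Pow {1..n}" if "k \<in> {Suc i..<r}" for k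
        using A_sub[of k] that by simp
      then show "A ` {Suc i..<r} \<subseteq> Pow {1..n}" by blast
    qed
    show "N i \<inter> component n (A i) = {\<one>\<^bsub>G n\<^esub>}"
      unfolding N_def using i by (intro common_kernel_inter_component) auto
  qed
qed

end

lemma bij_betw_set_sym_multi_indices: "bij_betw set (sym_multi_indices n) (Pow {1..n})"
proof (rule bij_betw_byWitness[where f' = sorted_list_of_set])
  show "\<forall>\<alpha>\<in>sym_multi_indices n. sorted_list_of_set (set \<alpha>) = \<alpha>"
    by (auto simp: sym_multi_indices_def strict_sorted_iff
        intro: sorted_list_of_set.idem_if_sorted_distinct)
  show "\<forall>A\<in>Pow {1..n}. set (sorted_list_of_set A) = A"
    using finite_subset by fastforce
  show "set ` sym_multi_indices n \<subseteq> Pow {1..n}"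
    by (auto simp: sym_multi_indices_def)
  show "sorted_list_of_set ` Pow {1..n} \<subseteq> sym_multi_indices n"
    using finite_subset by (fastforce simp: sym_multi_indices_def)
qed

theorem mainTheorem2:
  fixes G :: "nat \<Rightarrow> ('a, 'b) monoid_scheme"
    and act :: "nat \<Rightarrow> nat \<Rightarrow> (nat \<Rightarrow> nat) \<Rightarrow> 'a \<Rightarrow> 'a"
    and n :: nat
    and \<alpha> :: "nat \<Rightarrow> nat list"
  assumes "symmetric_simplicial_group G act"
    and "bij_betw \<alpha> {0..<2 ^ n} (sym_multi_indices n)"
    and "\<And>k l. \<lbrakk>k < 2 ^ n; l < 2 ^ n; set (\<alpha> k) \<subseteq> set (\<alpha> l)\<rbrakk> \<Longrightarrow> k \<le> l"
  shows "internal_sdp (G n) (map (\<lambda>k. U_set G act n (\<alpha> k)) [0..<2 ^ n])"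
proof -
  interpret symmetric_simplicial_group G act by (rule assms(1))
  have "bij_betw (set \<circ> \<alpha>) {0..<2 ^ n} (Pow {1..n})"
    using assms(2) bij_betw_set_sym_multi_indices by (rule bij_betw_trans)
  then have sdp: "internal_sdp (G n) (map (\<lambda>k. component n ((set \<circ> \<alpha>) k)) [0..<2 ^ n])"
    by (rule internal_sdp_components) (use assms(3) in auto)
  have "U_set G act n (\<alpha> k) = component n (set (\<alpha> k))" if "k < 2 ^ n" for k
    using bij_betwE[OF assms(2)] that by (intro U_set_eq_component) auto
  then have eq: "map (\<lambda>k. U_set G act n (\<alpha> k)) [0..<2 ^ n] =
      map (\<lambda>k. component n ((set \<circ> \<alpha>) k)) [0..<2 ^ n]"
    by (intro map_cong) auto
  show ?thesis unfolding eq by (rule sdp)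
qed

end
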